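(* Let $A,B$ be real symmetric $n\times n$ matrices. Assume that $A$ is a Robinsonian similarity matrix and $B$ is a Robinsonian dissimilarity matrix, and let $\pi,\tau$ be permutations of $[n]$ such that $A_\pi$ is a Robinson similarity matrix and $B_\tau$ is a Robinson dissimilarity matrix. Assume furthermore that one of the matrices $A_\pi$ or $B_\tau$ is a Toeplitz matrix. Then the permutation $\tau\pi^{-1}$ (that is, $i\mapsto \tau(\pi^{-1}(i))$) is optimal for the problem $\mathrm{QAP}(A,B)$.
   Context: $[n]=\{1,\ldots,n\}$. For real $n\times n$ matrices $A,B$, the quadratic assignment problem $\mathrm{QAP}(A,B)$ is $\min_{\sigma}\sum_{i,j=1}^n A_{ij}B_{\sigma(i)\sigma(j)}$, the minimum being over all permutations $\sigma$ of $[n]$; a permutation is optimal if it attains this minimum. For a permutation $\pi$ of $[n]$ and a symmetric matrix $A$, $A_\pi=(A_{\pi(i)\pi(j)})_{i,j=1}^n$. A real symmetric $n\times n$ matrix $A$ is a Robinson similarity matrix if $A_{ik}\le \min\{A_{ij},A_{jk}\}$ for all $1\le i\le j\le k\le n$; a real symmetric matrix $B$ is a Robinson dissimilarity matrix if $-B$ is a Robinson similarity matrix. A symmetric matrix $A$ is a Robinsonian similarity if $A_\pi$ is a Robinson similarity matrix for some permutation $\pi$ of $[n]$; $B$ is a Robinsonian dissimilarity if $-B$ is a Robinsonian similarity. A real $n\times n$ matrix $A$ is a Toeplitz matrix if $A_{ij}=A_{i+1,j+1}$ for all $1\le i,j\le n-1$. *)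

theory Defs
  imports "Jordan_Normal_Form.Matrix" "HOL-Combinatorics.Permutations"
begin

(* Matrices are indexed from 0, so the index set [n] = {1,...,n} is rendered as {0..<n},
   and "permutation of [n]" as "permutes {0..<n}". *)

definition symmetric_mat :: "real mat \<Rightarrow> bool" where
  "symmetric_mat A \<longleftrightarrow> square_mat A \<and> transpose_mat A = A"

definition permute_mat :: "(nat \<Rightarrow> nat) \<Rightarrow> real mat \<Rightarrow> real mat" where
  "permute_mat p A = mat (dim_row A) (dim_col A) (\<lambda>(i, j). A $$ (p i, p j))"

definition robinson_similarity :: "real mat \<Rightarrow> bool" where
  "robinson_similarity A \<longleftrightarrow> symmetric_mat A \<and>
     (\<forall>i j k. i \<le> j \<and> j \<le> k \<and> k < dim_row A \<longrightarrow>
        A $$ (i, k) \<le> min (A $$ (i, j)) (A $$ (j, k)))"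

definition robinson_dissimilarity :: "real mat \<Rightarrow> bool" where
  "robinson_dissimilarity B \<longleftrightarrow> robinson_similarity (- B)"

definition robinsonian_similarity :: "real mat \<Rightarrow> bool" where
  "robinsonian_similarity A \<longleftrightarrow> symmetric_mat A \<and>
     (\<exists>p. p permutes {0..<dim_row A} \<and> robinson_similarity (permute_mat p A))"

definition robinsonian_dissimilarity :: "real mat \<Rightarrow> bool" where
  "robinsonian_dissimilarity B \<longleftrightarrow> robinsonian_similarity (- B)"

definition toeplitz_mat :: "real mat \<Rightarrow> bool" where
  "toeplitz_mat A \<longleftrightarrow> square_mat A \<and>
     (\<forall>i j. Suc i < dim_row A \<and> Suc j < dim_row A \<longrightarrow>
        A $$ (i, j) = A $$ (Suc i, Suc j))"

definition qap_cost :: "real mat \<Rightarrow> real mat \<Rightarrow> (nat \<Rightarrow> nat) \<Rightarrow> real" where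
  "qap_cost A B s =
     (\<Sum>i = 0..<dim_row A. \<Sum>j = 0..<dim_row A. A $$ (i, j) * B $$ (s i, s j))"

(* The minimum is over a finite nonempty set. *)
definition QAP :: "real mat \<Rightarrow> real mat \<Rightarrow> real" where
  "QAP A B = Min (qap_cost A B ` {s. s permutes {0..<dim_row A}})"

definition qap_optimal :: "real mat \<Rightarrow> real mat \<Rightarrow> (nat \<Rightarrow> nat) \<Rightarrow> bool" where
  "qap_optimal A B s \<longleftrightarrow> s permutes {0..<dim_row A} \<and> qap_cost A B s = QAP A B"

end

theory Submission
  imports Defs
begin

text \<open>
  After relabelling by \<open>\<pi>\<close> and \<open>\<tau>\<close>, the claim is that the identity is optimal when \<open>A\<close> is a
  Robinson similarity, \<open>B\<close> is a Robinson dissimilarity and one of them is Toeplitz. The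
  problem is unchanged when \<open>(A, B, \<sigma>)\<close> is replaced by \<open>(- B, - A, \<sigma>\<inverse>)\<close>, so \<open>B\<close> may be taken
  to be Toeplitz: \<open>B\<^sub>i\<^sub>j = b \<bar>i - j\<bar>\<close> with \<open>b\<close> nondecreasing. Then \<open>b\<close> is a constant minus a
  nonnegative combination of the threshold functions \<open>d \<mapsto> [d < k]\<close>, and it suffices that,
  among all placements of the vertices on a line, the natural order maximizes the total
  weight of the pairs at distance less than \<open>k\<close> (\<open>band_weight_le_id\<close>).

  This is proved by removing the last vertex \<open>v\<close>, which sits at some position \<open>q\<close>. Closing the
  gap destroys the pairs that \<open>v\<close> forms, but it brings into the band the pairs at
  distance exactly \<open>k\<close> that straddle \<open>q\<close> (\<open>band_weight_remove\<close>). For \<open>0 < s < k\<close> let \<open>x\<close> and \<open>y\<close>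
  be the vertices at the positions \<open>q - s\<close> and \<open>q - s + k\<close>. Since \<open>v\<close> is the last vertex, the
  Robinson property gives \<open>min (w x v) (w y v) \<le> w x y\<close>, that is,
  \<open>w x v + w y v - w x y \<le> max (w x v) (w y v)\<close>. So the net loss is at most a sum of the
  weights between \<open>v\<close> and at most \<open>k - 1\<close> distinct vertices, and the natural order attains
  the largest such sum: it uses the \<open>k - 1\<close> vertices just before \<open>v\<close>, or all of them if there
  are fewer, and these have the largest weights (\<open>removal_loss_le\<close>). Here weights must be
  nonnegative, which adding a constant to all of them achieves.
\<close>

section \<open>Pairs at bounded distance\<close>

definition band :: "nat \<Rightarrow> nat \<Rightarrow> (nat \<times> nat) set" where
  "band n k = {(i, j). i < j \<and> j < i + k \<and> j < n}"

text \<open>The argument \<open>p\<close> maps a position on the line to the vertex placed there.\<close>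

definition band_weight ::
    "(nat \<Rightarrow> nat \<Rightarrow> real) \<Rightarrow> nat \<Rightarrow> nat \<Rightarrow> (nat \<Rightarrow> nat) \<Rightarrow> real" where
  "band_weight w n k p = (\<Sum>(i, j)\<in>band n k. w (p i) (p j))"

text \<open>The increasing enumeration of the positions other than \<open>q\<close>.\<close>

definition skip :: "nat \<Rightarrow> nat \<Rightarrow> nat" where
  "skip q i = (if i < q then i else Suc i)"

lemma finite_band [simp]: "finite (band n k)"
  by (rule finite_subset[of _ "{..<n} \<times> {..<n}"]) (auto simp: band_def)

lemma inj_skip: "inj (skip q)"
  by (auto simp: inj_def skip_def split: if_splits)

lemma skip_image: "q \<le> n \<Longrightarrow> skip q ` {..<n} = {..<Suc n} - {q}"
proof (intro equalityI subsetI)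
  fix x assume "q \<le> n" "x \<in> {..<Suc n} - {q}"
  then show "x \<in> skip q ` {..<n}"
    by (intro image_eqI[of _ _ "if x < q then x else x - 1"]) (auto simp: skip_def)
qed (auto simp: skip_def)

lemma band_Suc_eq:
  assumes "q \<le> n"
  shows "band (Suc n) k =
    map_prod (skip q) (skip q) ` (band n k - (\<lambda>i. (i, i + k - 1)) ` {i. i < q \<and> q < i + k \<and> i + k \<le> n})
    \<union> ((\<lambda>i. (i, q)) ` {i. i < q \<and> q < i + k} \<union> (\<lambda>j. (q, j)) ` {j. q < j \<and> j < q + k \<and> j \<le> n})"
    (is "_ = ?old \<union> ?new")
proof (intro equalityI subsetI)
  fix e assume e: "e \<in> band (Suc n) k"
  obtain i j where ij: "e = (i, j)" "i < j" "j < i + k" "j \<le> n"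
    using e by (auto simp: band_def)
  show "e \<in> ?old \<union> ?new"
  proof (cases "i = q \<or> j = q")
    case True
    then show ?thesis using ij by auto
  next
    case False
    define i' j' where "i' = (if i < q then i else i - 1)" and "j' = (if j < q then j else j - 1)"
    have "e = map_prod (skip q) (skip q) (i', j')"
      using ij False by (auto simp: i'_def j'_def skip_def)
    moreover have "(i', j') \<in> band n k"
      using ij False assms by (auto simp: i'_def j'_def band_def)
    moreover have "(i', j') \<notin> (\<lambda>i. (i, i + k - 1)) ` {i. i < q \<and> q < i + k \<and> i + k \<le> n}"
      using ij False by (auto simp: i'_def j'_def split: if_splits)
    ultimately show ?thesis by blast
  qed
next
  fix e assume "e \<in> ?old \<union> ?new"
  then show "e \<in> band (Suc n) k"
    using assms by (auto simp: band_def skip_def image_iff split: if_splits)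
qed

text \<open>
  Deleting position \<open>q\<close> shortens exactly the distances across \<open>q\<close>, each by one. The pairs that
  enter the band are therefore those across \<open>q\<close> at distance \<open>k\<close>.
\<close>

lemma band_weight_remove:
  assumes "q \<le> n"
  shows "band_weight w (Suc n) k p + (\<Sum>i | i < q \<and> q < i + k \<and> i + k \<le> n. w (p i) (p (i + k)))
       = band_weight w n k (p \<circ> skip q) + (\<Sum>i | i < q \<and> q < i + k. w (p i) (p q))
         + (\<Sum>j | q < j \<and> j < q + k \<and> j \<le> n. w (p q) (p j))"
proof -
  let ?I = "{i. i < q \<and> q < i + k \<and> i + k \<le> n}"
  let ?D = "(\<lambda>i. (i, i + k - 1)) ` ?I"
  let ?L = "{i. i < q \<and> q < i + k}"
  let ?R = "{j. q < j \<and> j < q + k \<and> j \<le> n}"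
  let ?g = "\<lambda>(i, j). w (p i) (p j)"
  let ?S = "map_prod (skip q) (skip q)"
  have inj: "inj_on ?S X" for X
    by (rule inj_on_subset[OF prod.inj_map[OF inj_skip inj_skip]]) simp
  have D: "?D \<subseteq> band n k"
    by (auto simp: band_def)
  have [simp]: "finite ?L" "finite ?R" by auto
  have "band_weight w (Suc n) k p
      = sum ?g (?S ` (band n k - ?D)) + sum ?g ((\<lambda>i. (i, q)) ` ?L \<union> (\<lambda>j. (q, j)) ` ?R)"
    unfolding band_weight_def band_Suc_eq[OF assms]
    by (rule sum.union_disjoint) (auto simp: skip_def split: if_splits)
  also have "sum ?g ((\<lambda>i. (i, q)) ` ?L \<union> (\<lambda>j. (q, j)) ` ?R)
      = sum ?g ((\<lambda>i. (i, q)) ` ?L) + sum ?g ((\<lambda>j. (q, j)) ` ?R)"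
    by (rule sum.union_disjoint) auto
  also have "sum ?g ((\<lambda>i. (i, q)) ` ?L) = (\<Sum>i\<in>?L. w (p i) (p q))"
    by (subst sum.reindex) (auto simp: inj_on_def)
  also have "sum ?g ((\<lambda>j. (q, j)) ` ?R) = (\<Sum>j\<in>?R. w (p q) (p j))"
    by (subst sum.reindex) (auto simp: inj_on_def)
  also have "sum ?g (?S ` (band n k - ?D)) = sum (?g \<circ> ?S) (band n k - ?D)"
    by (rule sum.reindex[OF inj])
  also have "\<dots> = sum (?g \<circ> ?S) (band n k) - sum (?g \<circ> ?S) ?D"
    by (rule sum_diff[OF finite_band D])
  also have "sum (?g \<circ> ?S) (band n k) = band_weight w n k (p \<circ> skip q)"
    unfolding band_weight_def by (rule sum.cong) auto
  also have "sum (?g \<circ> ?S) ?D = (\<Sum>i\<in>?I. w (p i) (p (i + k)))"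
    by (subst sum.reindex) (auto simp: inj_on_def skip_def intro!: sum.cong)
  finally show ?thesis by (simp add: comp_def)
qed

section \<open>The natural order maximizes the weight of the band\<close>

lemma sum_le_sum_top:
  fixes f :: "nat \<Rightarrow> real"
  assumes X: "X \<subseteq> {..<n}" and card: "card X < k"
    and mono: "\<And>x y. x \<le> y \<Longrightarrow> y < n \<Longrightarrow> f x \<le> f y"
    and nonneg: "\<And>x. x < n \<Longrightarrow> 0 \<le> f x"
  shows "sum f X \<le> (\<Sum>x | x < n \<and> n < x + k. f x)"
proof -
  let ?T = "{x. x < n \<and> n < x + k}"
  have fin: "finite X" "finite ?T"
    using X finite_subset by auto
  show ?thesis
  proof (cases "n < k")
    case True
    then show ?thesis using X nonneg by (intro sum_mono2) auto
  next
    case False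
    define m where "m = n - k + 1"
    have T: "?T = {m..<n}" using False card by (auto simp: m_def)
    have m: "m \<le> n" and cT: "card ?T = k - 1" using False card unfolding T by (auto simp: m_def)
    have "card (X - ?T) \<le> card (?T - X)"
      using card_Int_Diff[OF fin(1), of ?T] card_Int_Diff[OF fin(2), of X] card cT
      by (simp add: Int_commute)
    show ?thesis
    proof (cases "X - ?T = {}")
      case True
      then show ?thesis using nonneg fin by (intro sum_mono2) auto
    next
      case ne: False
      have mn: "m < n"
        using \<open>card (X - ?T) \<le> card (?T - X)\<close> ne fin T by (cases "m < n") auto
      have "sum f (X - ?T) \<le> card (X - ?T) * f m"
        using X mn unfolding T by (intro sum_bounded_above mono) auto
      also have "\<dots> \<le> card (?T - X) * f m"
        using \<open>card (X - ?T) \<le> card (?T - X)\<close> nonneg mn by (intro mult_right_mono) auto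
      also have "\<dots> \<le> sum f (?T - X)"
        unfolding T by (intro sum_bounded_below mono) auto
      finally show ?thesis
        using sum.Int_Diff[OF fin(1), of f ?T] sum.Int_Diff[OF fin(2), of f X]
        by (simp add: Int_commute)
    qed
  qed
qed

definition robinson_on :: "nat \<Rightarrow> (nat \<Rightarrow> nat \<Rightarrow> real) \<Rightarrow> bool" where
  "robinson_on n w \<longleftrightarrow> (\<forall>x<n. \<forall>y<n. w x y = w y x) \<and>
     (\<forall>x y z. x \<le> y \<and> y \<le> z \<and> z < n \<longrightarrow> w x z \<le> w x y \<and> w x z \<le> w y z)"

lemma robinson_on_less: "robinson_on n w \<Longrightarrow> m \<le> n \<Longrightarrow> robinson_on m w"
  unfolding robinson_on_def by (meson order_less_le_trans)

text \<open>
  The edge from \<open>v\<close> to the first of \<open>x\<close> and \<open>y\<close> spans the other one, so it is at most \<open>w x y\<close>.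
  This is what lets a gained pair pay for the lighter of the two pairs lost.
\<close>

lemma robinson_on_triangle:
  assumes "robinson_on (Suc v) w" "x < v" "y < v"
  shows "w x v + w v y - w x y \<le> max (w v x) (w v y)"
proof (cases "x \<le> y")
  case True
  then have "w x v \<le> w x y" using assms by (auto simp: robinson_on_def)
  then show ?thesis by simp
next
  case False
  then have "y \<le> x \<and> x \<le> v \<and> v < Suc v" using assms by simp
  then have "w y v \<le> w y x" using assms(1) unfolding robinson_on_def by blast
  moreover have sym: "w a b = w b a" if "a \<le> v" "b \<le> v" for a b
    using assms(1) that by (simp add: robinson_on_def)
  ultimately show ?thesis
    using sym[of y v] sym[of y x] sym[of x v] assms by simp
qed

text \<open>
  The left side is the weight that the band loses when position \<open>q\<close>, which holds the last
  vertex \<open>n\<close>, is deleted. The positions \<open>q - s\<close> and \<open>q - s + k\<close> with \<open>0 < s < k\<close> exhaust the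
  neighbourhood of \<open>q\<close>, and the only pairs gained are those formed by both members of such a
  couple. By \<open>robinson_on_triangle\<close> each couple contributes at most its heavier edge to \<open>n\<close>.
\<close>

lemma removal_loss_le:
  assumes rob: "robinson_on (Suc n) w"
    and nonneg: "\<And>x y. x \<le> n \<Longrightarrow> y \<le> n \<Longrightarrow> 0 \<le> w x y"
    and p: "bij_betw p {..<Suc n} {..<Suc n}" and q: "q \<le> n" "p q = n"
  shows "(\<Sum>i | i < q \<and> q < i + k. w (p i) (p q)) + (\<Sum>j | q < j \<and> j < q + k \<and> j \<le> n. w (p q) (p j))
       - (\<Sum>i | i < q \<and> q < i + k \<and> i + k \<le> n. w (p i) (p (i + k)))
       \<le> (\<Sum>x | x < n \<and> n < x + k. w x n)" (is "?l + ?r - ?g \<le> _")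
proof -
  define L where "L = {s \<in> {1..<k}. s \<le> q}"
  define R where "R = {s \<in> {1..<k}. q + k - s \<le> n}"
  have fin: "finite L" "finite R" by (auto simp: L_def R_def)
  have pn: "p i < n" if "i \<le> n" "i \<noteq> q" for i
  proof -
    have "p i < Suc n" using bij_betwE[OF p] that by auto
    moreover have "p i \<noteq> p q"
      using bij_betw_imp_inj_on[OF p] that q unfolding inj_on_def by auto
    ultimately show ?thesis using q by simp
  qed
  have sym: "w x y = w y x" if "x \<le> n" "y \<le> n" for x y
    using rob that by (auto simp: robinson_on_def)
  have l: "?l = (\<Sum>s\<in>L. w (p (q - s)) n)"
    by (rule sum.reindex_bij_witness[of _ "\<lambda>s. q - s" "\<lambda>i. q - i"]) (use q in \<open>auto simp: L_def\<close>)
  have r: "?r = (\<Sum>s\<in>R. w n (p (q + k - s)))"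
    by (rule sum.reindex_bij_witness[of _ "\<lambda>s. q + k - s" "\<lambda>j. q + k - j"])
      (use q in \<open>auto simp: R_def\<close>)
  have g: "?g = (\<Sum>s\<in>L \<inter> R. w (p (q - s)) (p (q + k - s)))"
    by (rule sum.reindex_bij_witness[of _ "\<lambda>s. q - s" "\<lambda>i. q - i"]) (auto simp: L_def R_def add.commute)
  \<comment> \<open>\<open>h s\<close> is the position, among those of \<open>q - s\<close> and \<open>q - s + k\<close> that exist, of the vertex
    with the heavier edge to \<open>n\<close>. It is injective because it determines \<open>s\<close> modulo \<open>k\<close>.\<close>
  define h where "h s = (if s \<in> L \<and> (s \<in> R \<longrightarrow> w n (p (q + k - s)) \<le> w n (p (q - s)))
    then q - s else q + k - s)" for s
  have h: "h s \<le> n" "h s \<noteq> q" if "s \<in> L \<union> R" for s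
    using that q by (auto simp: h_def L_def R_def)
  have inj_h: "inj_on h (L \<union> R)"
    by (auto simp: inj_on_def h_def L_def R_def split: if_splits)
  have inj_ph: "inj_on (p \<circ> h) (L \<union> R)"
    using h by (intro comp_inj_on[OF inj_h] inj_on_subset[OF bij_betw_imp_inj_on[OF p]]) 
      (auto simp: less_Suc_eq_le)
  have "?l + ?r - ?g = (\<Sum>s\<in>L \<union> R. (if s \<in> L then w (p (q - s)) n else 0)
      + (if s \<in> R then w n (p (q + k - s)) else 0)
      - (if s \<in> L \<inter> R then w (p (q - s)) (p (q + k - s)) else 0))"
    unfolding l r g sum_subtractf sum.distrib using fin
    by (intro arg_cong2[of _ _ _ _ "(-)"] arg_cong2[of _ _ _ _ "(+)"] sum.mono_neutral_cong_left) auto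
  also have "\<dots> \<le> (\<Sum>s\<in>L \<union> R. w n (p (h s)))"
  proof (rule sum_mono, goal_cases)
    case (1 s)
    have a: "p (q - s) < n" if "s \<in> L"
      using that q by (intro pn) (auto simp: L_def)
    have b: "p (q + k - s) < n" if "s \<in> R"
      using that q by (intro pn) (auto simp: R_def)
    consider "s \<in> L" "s \<in> R" | "s \<in> L" "s \<notin> R" | "s \<notin> L" "s \<in> R" using 1 by auto
    then show ?case
    proof cases
      case 1
      then show ?thesis
        using robinson_on_triangle[OF rob a b] by (auto simp: h_def max_def split: if_splits)
    qed (use a sym[of n "p (q - s)"] in \<open>auto simp: h_def\<close>)
  qed
  also have "\<dots> = (\<Sum>x\<in>(p \<circ> h) ` (L \<union> R). w n x)"
    by (subst sum.reindex[OF inj_ph]) simp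
  also have "\<dots> \<le> (\<Sum>x | x < n \<and> n < x + k. w n x)"
  proof (cases "L \<union> R = {}")
    case True
    then show ?thesis using nonneg by (auto intro!: sum_nonneg)
  next
    case False
    then have "1 < k" by (auto simp: L_def R_def)
    moreover have "card ((p \<circ> h) ` (L \<union> R)) \<le> card {1..<k}"
      using fin by (intro order.trans[OF card_image_le] card_mono) (auto simp: L_def R_def)
    ultimately have "card ((p \<circ> h) ` (L \<union> R)) < k" by simp
    then show ?thesis
    proof (rule sum_le_sum_top[rotated])
      fix x y assume "x \<le> y" "y < n"
      then have "w x n \<le> w y n" using rob by (auto simp: robinson_on_def)
      then show "w n x \<le> w n y" using sym[of x n] sym[of y n] \<open>x \<le> y\<close> \<open>y < n\<close> by simp
    qed (use pn h nonneg in auto)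
  qed
  also have "\<dots> = (\<Sum>x | x < n \<and> n < x + k. w x n)"
    by (rule sum.cong) (auto intro: sym)
  finally show ?thesis .
qed

lemma band_weight_le_id:
  assumes "robinson_on n w"
    and "\<And>x y. x < n \<Longrightarrow> y < n \<Longrightarrow> 0 \<le> w x y"
    and "bij_betw p {..<n} {..<n}"
  shows "band_weight w n k p \<le> band_weight w n k id"
  using assms
proof (induction n arbitrary: p)
  case 0
  then show ?case by (simp add: band_weight_def band_def)
next
  case (Suc n)
  have "n \<in> p ` {..<Suc n}" using bij_betw_imp_surj_on[OF Suc.prems(3)] by simp
  then obtain q where q: "q \<le> n" "p q = n"
    by (metis imageE lessThan_iff less_Suc_eq_le)
  have "bij_betw (skip q) {..<n} ({..<Suc n} - {q})"
    using inj_skip skip_image[OF q(1)] by (auto simp: bij_betw_def intro: inj_on_subset)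
  moreover have "bij_betw p ({..<Suc n} - {q}) ({..<Suc n} - {n})"
    by (intro bij_betw_DiffI Suc.prems(3)) (use q in \<open>auto simp: bij_betw_def\<close>)
  moreover have "{..<Suc n} - {n} = {..<n}" by auto
  ultimately have "bij_betw (p \<circ> skip q) {..<n} {..<n}"
    by (metis bij_betw_trans)
  then have IH: "band_weight w n k (p \<circ> skip q) \<le> band_weight w n k id"
    using Suc.prems by (intro Suc.IH) (auto simp: comp_def intro: robinson_on_less)
  have loss: "(\<Sum>i | i < q \<and> q < i + k. w (p i) (p q))
      + (\<Sum>j | q < j \<and> j < q + k \<and> j \<le> n. w (p q) (p j))
      - (\<Sum>i | i < q \<and> q < i + k \<and> i + k \<le> n. w (p i) (p (i + k)))
      \<le> (\<Sum>x | x < n \<and> n < x + k. w x n)"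
    using Suc.prems q by (intro removal_loss_le) auto
  \<comment> \<open>In the natural order the last vertex is at the last position, and no pair straddles it.\<close>
  have "band_weight w n k (id \<circ> skip n) = band_weight w n k id"
    unfolding band_weight_def by (rule sum.cong) (auto simp: band_def skip_def)
  moreover have "{i. i < n \<and> n < i + k \<and> i + k \<le> n} = {}" "{j. n < j \<and> j < n + k \<and> j \<le> n} = {}"
    by auto
  ultimately have "band_weight w (Suc n) k id
      = band_weight w n k id + (\<Sum>x | x < n \<and> n < x + k. w x n)"
    using band_weight_remove[of n n w k id] by (simp only: sum.empty id_apply) simp
  then show ?case
    using band_weight_remove[OF q(1), of w k p] IH loss by linarith
qed

section \<open>From bands to monotone functions of the distance\<close>

text \<open>In truncated subtraction, \<open>(i - j) + (j - i)\<close> is the distance of \<open>i\<close> and \<open>j\<close>.\<close>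

definition distance_cost ::
    "nat \<Rightarrow> (nat \<Rightarrow> nat \<Rightarrow> real) \<Rightarrow> (nat \<Rightarrow> real) \<Rightarrow> (nat \<Rightarrow> nat) \<Rightarrow> real" where
  "distance_cost n w b p = (\<Sum>i<n. \<Sum>j<n. w (p i) (p j) * b ((i - j) + (j - i)))"

lemma sum_sum_bij:
  fixes w :: "nat \<Rightarrow> nat \<Rightarrow> real"
  assumes "bij_betw p {..<n} {..<n}"
  shows "(\<Sum>i<n. \<Sum>j<n. w (p i) (p j)) = (\<Sum>i<n. \<Sum>j<n. w i j)"
proof -
  have "(\<Sum>i<n. \<Sum>j<n. w (p i) (p j)) = (\<Sum>i<n. \<Sum>j<n. w (p i) j)"
    by (intro sum.cong refl sum.reindex_bij_betw[OF assms])
  also have "\<dots> = (\<Sum>i<n. \<Sum>j<n. w i j)"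
    by (rule sum.reindex_bij_betw[OF assms])
  finally show ?thesis .
qed

lemma distance_cost_threshold:
  assumes "robinson_on n w" and p: "bij_betw p {..<n} {..<n}" and "0 < k"
  shows "distance_cost n w (\<lambda>d. of_bool (d < k)) p = (\<Sum>i<n. w i i) + 2 * band_weight w n k p"
proof -
  let ?g = "\<lambda>(i, j). w (p i) (p j)"
  let ?dg = "(\<lambda>i. (i, i)) ` {..<n}"
  let ?near = "{(i, j) \<in> {..<n} \<times> {..<n}. (i - j) + (j - i) < k}"
  have near: "?near = ?dg \<union> (band n k \<union> prod.swap ` band n k)"
    using \<open>0 < k\<close> by (auto simp: band_def image_iff)
  have "distance_cost n w (\<lambda>d. of_bool (d < k)) p
      = (\<Sum>e\<in>{..<n} \<times> {..<n}. ?g e * of_bool (fst e - snd e + (snd e - fst e) < k))"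
    unfolding distance_cost_def sum.cartesian_product by (rule sum.cong) auto
  also have "\<dots> = sum ?g ?near"
    by (rule sum.mono_neutral_cong_right) auto
  also have "\<dots> = sum ?g ?dg + sum ?g (band n k \<union> prod.swap ` band n k)"
    unfolding near by (rule sum.union_disjoint) (simp, simp, auto simp: band_def)
  also have "sum ?g (band n k \<union> prod.swap ` band n k)
      = sum ?g (band n k) + sum ?g (prod.swap ` band n k)"
    by (rule sum.union_disjoint) (simp, simp, auto simp: band_def)
  also have "sum ?g (prod.swap ` band n k) = sum (?g \<circ> prod.swap) (band n k)"
    by (rule sum.reindex) simp
  also have "\<dots> = sum ?g (band n k)"
  proof (rule sum.cong[OF refl], clarsimp)
    fix i j assume "(i, j) \<in> band n k"
    then have "p i < n" "p j < n" using bij_betwE[OF p] by (auto simp: band_def)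
    then show "w (p j) (p i) = w (p i) (p j)" using assms(1) by (auto simp: robinson_on_def)
  qed
  also have "sum ?g ?dg = (\<Sum>i<n. w (p i) (p i))"
    by (subst sum.reindex) (auto simp: inj_on_def)
  also have "\<dots> = (\<Sum>i<n. w i i)"
    by (rule sum.reindex_bij_betw[OF p])
  finally show ?thesis by (simp add: band_weight_def)
qed

text \<open>
  Summation by parts writes \<open>b\<close> through thresholds, with the increments of \<open>b\<close> as the coefficients.
\<close>

lemma threshold_decomposition:
  fixes b :: "nat \<Rightarrow> real"
  assumes "d \<le> N"
  shows "b d = b N - (\<Sum>k<N. (b (Suc k) - b k) * of_bool (d < Suc k))"
  using assms
proof (induction N rule: dec_induct)
  case base
  have "(\<Sum>k<d. (b (Suc k) - b k) * of_bool (d < Suc k)) = 0"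
    by (rule sum.neutral) auto
  then show ?case by simp
qed simp

lemma distance_cost_id_le:
  assumes rob: "robinson_on n w" and p: "bij_betw p {..<n} {..<n}"
    and mono: "\<And>d. Suc d < n \<Longrightarrow> b d \<le> b (Suc d)"
  shows "distance_cost n w b id \<le> distance_cost n w b p"
proof -
  \<comment> \<open>Adding a constant to all weights changes all costs equally and makes the weights nonnegative.\<close>
  define c where "c = (\<Sum>x<n. \<Sum>y<n. \<bar>w x y\<bar>)"
  define u where "u x y = w x y + c" for x y
  have shift: "distance_cost n u f r
      = distance_cost n w f r + c * (\<Sum>i<n. \<Sum>j<n. f ((i - j) + (j - i)))" for f r
    by (simp add: distance_cost_def u_def distrib_right sum.distrib sum_distrib_left)
  have u: "robinson_on n u"
    using rob by (auto simp: robinson_on_def u_def)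
  have nonneg: "0 \<le> u x y" if "x < n" "y < n" for x y
  proof -
    have "\<bar>w x y\<bar> \<le> (\<Sum>y<n. \<bar>w x y\<bar>)"
      using that by (intro member_le_sum) auto
    also have "\<dots> \<le> c"
      unfolding c_def using that
      by (intro member_le_sum[of x _ "\<lambda>x. \<Sum>y<n. \<bar>w x y\<bar>"] sum_nonneg) auto
    finally show ?thesis by (simp add: u_def)
  qed
  have id: "bij_betw id {..<n} {..<n}" by simp
  define N where "N = n - 1"
  have expand: "distance_cost n u b r = b N * (\<Sum>i<n. \<Sum>j<n. u i j)
      - (\<Sum>k<N. (b (Suc k) - b k) * distance_cost n u (\<lambda>d. of_bool (d < Suc k)) r)"
    if r: "bij_betw r {..<n} {..<n}" for r
  proof -
    have "distance_cost n u b r = (\<Sum>i<n. \<Sum>j<n. b N * u (r i) (r j)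
        - (\<Sum>k<N. (b (Suc k) - b k) * (u (r i) (r j) * of_bool (i - j + (j - i) < Suc k))))"
      unfolding distance_cost_def
    proof (intro sum.cong refl)
      fix i j assume "i \<in> {..<n}" "j \<in> {..<n}"
      then have "(i - j) + (j - i) \<le> N" by (auto simp: N_def)
      note d = threshold_decomposition[OF this, of b]
      show "u (r i) (r j) * b (i - j + (j - i)) = b N * u (r i) (r j)
        - (\<Sum>k<N. (b (Suc k) - b k) * (u (r i) (r j) * of_bool (i - j + (j - i) < Suc k)))"
        by (subst d, simp only: right_diff_distrib sum_distrib_left, simp only: mult_ac)
    qed
    also have "\<dots> = b N * (\<Sum>i<n. \<Sum>j<n. u (r i) (r j))
        - (\<Sum>i<n. \<Sum>j<n. \<Sum>k<N.
            (b (Suc k) - b k) * (u (r i) (r j) * of_bool (i - j + (j - i) < Suc k)))"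
      by (simp only: sum_subtractf sum_distrib_left)
    also have "(\<Sum>i<n. \<Sum>j<n. \<Sum>k<N.
            (b (Suc k) - b k) * (u (r i) (r j) * of_bool (i - j + (j - i) < Suc k)))
        = (\<Sum>k<N. \<Sum>i<n. \<Sum>j<n.
            (b (Suc k) - b k) * (u (r i) (r j) * of_bool (i - j + (j - i) < Suc k)))"
      by (rule trans[OF sum.cong[OF refl sum.swap] sum.swap])
    finally show ?thesis
      unfolding distance_cost_def sum_sum_bij[OF r] by (simp only: sum_distrib_left)
  qed
  have "distance_cost n u (\<lambda>d. of_bool (d < Suc k)) p
      \<le> distance_cost n u (\<lambda>d. of_bool (d < Suc k)) id" for k
    using band_weight_le_id[OF u nonneg p]
    by (simp only: distance_cost_threshold[OF u p] distance_cost_threshold[OF u id]) simp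
  then have "distance_cost n u b id \<le> distance_cost n u b p"
    unfolding expand[OF p] expand[OF id] using mono
    by (intro diff_left_mono sum_mono mult_left_mono) (auto simp: N_def)
  then show ?thesis by (simp add: shift)
qed

section \<open>Robinson matrices with Toeplitz structure\<close>

lemma robinson_similarity_robinson_on:
  assumes "robinson_similarity M" "M \<in> carrier_mat n n"
  shows "robinson_on n (\<lambda>i j. M $$ (i, j))"
proof -
  have "M $$ (x, y) = M $$ (y, x)" if "x < n" "y < n" for x y
  proof -
    have "transpose_mat M = M" using assms by (simp add: robinson_similarity_def symmetric_mat_def)
    then show ?thesis using assms(2) that by (metis carrier_matD index_transpose_mat(1))
  qed
  then show ?thesis using assms by (auto simp: robinson_similarity_def robinson_on_def)
qed

lemma toeplitz_entry:
  assumes "toeplitz_mat M" "M \<in> carrier_mat n n" "i + d < n"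
  shows "M $$ (i, i + d) = M $$ (0, d)"
  using assms(3)
proof (induction i)
  case (Suc i)
  then have "M $$ (i, i + d) = M $$ (Suc i, Suc (i + d))"
    using assms(1,2) by (auto simp: toeplitz_mat_def)
  then show ?case using Suc by simp
qed simp

lemma qap_id_le_toeplitz:
  assumes M: "M \<in> carrier_mat n n" "robinson_similarity M"
    and K: "K \<in> carrier_mat n n" "robinson_similarity (- K)" "toeplitz_mat K"
    and p: "bij_betw p {..<n} {..<n}"
  shows "(\<Sum>i<n. \<Sum>j<n. M $$ (i, j) * K $$ (i, j)) \<le> (\<Sum>i<n. \<Sum>j<n. M $$ (p i, p j) * K $$ (i, j))"
proof -
  have K': "robinson_on n (\<lambda>i j. (- K) $$ (i, j))"
    using K by (intro robinson_similarity_robinson_on) auto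
  have entry: "K $$ (i, j) = K $$ (0, (i - j) + (j - i))" if "i < n" "j < n" for i j
  proof (cases "i \<le> j")
    case True
    then show ?thesis using toeplitz_entry[OF K(3,1), of i "j - i"] that by simp
  next
    case False
    have "K $$ (i, j) = K $$ (j, i)"
      using K' K(1) that by (auto simp: robinson_on_def)
    then show ?thesis using toeplitz_entry[OF K(3,1), of j "i - j"] that False by simp
  qed
  have "K $$ (0, d) \<le> K $$ (0, Suc d)" if "Suc d < n" for d
  proof -
    have "(- K) $$ (0, Suc d) \<le> (- K) $$ (0, d)"
      using K' that unfolding robinson_on_def by (meson le0 le_Suc_eq order_refl)
    then show ?thesis using K(1) that by simp
  qed
  note le = distance_cost_id_le[OF robinson_similarity_robinson_on[OF M(2,1)] p,
      of "\<lambda>d. K $$ (0, d)", OF this]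
  have "(\<Sum>i<n. \<Sum>j<n. M $$ (r i, r j) * K $$ (i, j))
      = distance_cost n (\<lambda>i j. M $$ (i, j)) (\<lambda>d. K $$ (0, d)) r" for r
    unfolding distance_cost_def
    by (intro sum.cong refl arg_cong2[where f = "(*)"] entry) auto
  from this[of id] this[of p] le show ?thesis by simp
qed

lemma qap_id_le:
  assumes M: "M \<in> carrier_mat n n" "robinson_similarity M"
    and K: "K \<in> carrier_mat n n" "robinson_similarity (- K)"
    and T: "toeplitz_mat M \<or> toeplitz_mat K"
    and p: "bij_betw p {..<n} {..<n}"
  shows "(\<Sum>i<n. \<Sum>j<n. M $$ (i, j) * K $$ (i, j)) \<le> (\<Sum>i<n. \<Sum>j<n. M $$ (i, j) * K $$ (p i, p j))"
  using T
proof
  assume T: "toeplitz_mat K"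
  \<comment> \<open>The sum is reindexed by the inverse of \<open>p\<close>, so that the Toeplitz matrix stays in place.\<close>
  let ?r = "inv_into {..<n} p"
  have r: "bij_betw ?r {..<n} {..<n}" by (rule bij_betw_inv_into[OF p])
  have pr: "p (?r i) = i" if "i < n" for i
    using bij_betw_inv_into_right[OF p] that by simp
  have "(\<Sum>i<n. \<Sum>j<n. M $$ (i, j) * K $$ (p i, p j))
      = (\<Sum>i<n. \<Sum>j<n. M $$ (?r i, ?r j) * K $$ (p (?r i), p (?r j)))"
    by (rule sum_sum_bij[OF r, symmetric])
  also have "\<dots> = (\<Sum>i<n. \<Sum>j<n. M $$ (?r i, ?r j) * K $$ (i, j))"
    by (intro sum.cong refl) (auto simp: pr)
  finally show ?thesis using qap_id_le_toeplitz[OF M K T r] by simp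
next
  assume T: "toeplitz_mat M"
  \<comment> \<open>The roles are exchanged: \<open>- K\<close> is the similarity, and \<open>- M\<close> is the Toeplitz dissimilarity.\<close>
  have N: "- (- M) = M" "toeplitz_mat (- M)" "- K \<in> carrier_mat n n" "- M \<in> carrier_mat n n"
    using T M(1) K(1) by (auto simp: toeplitz_mat_def)
  have pn: "p i < n" if "i < n" for i using bij_betwE[OF p] that by auto
  have "(\<Sum>i<n. \<Sum>j<n. (- K) $$ (i, j) * (- M) $$ (i, j))
      \<le> (\<Sum>i<n. \<Sum>j<n. (- K) $$ (p i, p j) * (- M) $$ (i, j))"
    using N M K p by (intro qap_id_le_toeplitz) auto
  moreover have "(\<Sum>i<n. \<Sum>j<n. (- K) $$ (i, j) * (- M) $$ (i, j))
      = (\<Sum>i<n. \<Sum>j<n. M $$ (i, j) * K $$ (i, j))"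
    using M(1) K(1) by (intro sum.cong refl) auto
  moreover have "(\<Sum>i<n. \<Sum>j<n. (- K) $$ (p i, p j) * (- M) $$ (i, j))
      = (\<Sum>i<n. \<Sum>j<n. M $$ (i, j) * K $$ (p i, p j))"
    using M(1) K(1) pn by (intro sum.cong refl) auto
  ultimately show ?thesis by simp
qed

theorem corollary1:
  fixes n :: nat and A B :: "real mat" and \<pi> \<tau> :: "nat \<Rightarrow> nat"
  assumes "A \<in> carrier_mat n n" and "B \<in> carrier_mat n n"
    and "symmetric_mat A" and "symmetric_mat B"
    and "robinsonian_similarity A" and "robinsonian_dissimilarity B"
    and "\<pi> permutes {0..<n}" and "\<tau> permutes {0..<n}"
    and "robinson_similarity (permute_mat \<pi> A)"
    and "robinson_dissimilarity (permute_mat \<tau> B)"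
    and "toeplitz_mat (permute_mat \<pi> A) \<or> toeplitz_mat (permute_mat \<tau> B)"
  shows "qap_optimal A B (\<tau> \<circ> Hilbert_Choice.inv \<pi>)"
proof -
  let ?M = "permute_mat \<pi> A" and ?K = "permute_mat \<tau> B"
  have \<pi>: "\<pi> permutes {..<n}" and \<tau>: "\<tau> permutes {..<n}"
    using assms(7,8) by (simp_all add: atLeast0LessThan)
  have dim [simp]: "dim_row A = n" "dim_col A = n" "dim_row B = n" "dim_col B = n"
    using assms(1,2) by auto
  have carrier: "?M \<in> carrier_mat n n" "?K \<in> carrier_mat n n"
    by (auto simp: permute_mat_def)
  let ?opt = "\<tau> \<circ> Hilbert_Choice.inv \<pi>"
  have opt: "?opt permutes {..<n}"
    by (rule permutes_compose[OF permutes_inv[OF \<pi>] \<tau>])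
  \<comment> \<open>In the coordinates of the permuted matrices, \<open>s\<close> becomes \<open>\<tau>\<inverse> s \<pi>\<close>.\<close>
  have cost: "qap_cost A B s
      = (\<Sum>i<n. \<Sum>j<n. ?M $$ (i, j) * ?K $$ (Hilbert_Choice.inv \<tau> (s (\<pi> i)), Hilbert_Choice.inv \<tau> (s (\<pi> j))))"
    if s: "s permutes {..<n}" for s
  proof -
    have in_n: "Hilbert_Choice.inv \<tau> (s (\<pi> i)) < n" if "i < n" for i
      using permutes_in_image[OF \<pi>] permutes_in_image[OF s] permutes_in_image[OF permutes_inv[OF \<tau>]] that
      by simp
    have "qap_cost A B s = (\<Sum>i<n. \<Sum>j<n. A $$ (\<pi> i, \<pi> j) * B $$ (s (\<pi> i), s (\<pi> j)))"
      unfolding qap_cost_def dim atLeast0LessThan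
      by (rule sum_sum_bij[OF permutes_imp_bij[OF \<pi>], symmetric])
    then show ?thesis
      using in_n by (simp add: permute_mat_def permutes_inverses[OF \<tau>])
  qed
  have "qap_cost A B ?opt \<le> qap_cost A B s" if s: "s permutes {..<n}" for s
  proof -
    have "bij_betw (Hilbert_Choice.inv \<tau> \<circ> s \<circ> \<pi>) {..<n} {..<n}"
      by (intro permutes_imp_bij permutes_compose \<pi> s permutes_inv[OF \<tau>])
    from qap_id_le[OF carrier(1) assms(9) carrier(2) _ assms(11) this]
    show ?thesis
      using assms(10) unfolding cost[OF s] cost[OF opt]
      by (simp add: robinson_dissimilarity_def permutes_inverses[OF \<tau>] permutes_inverses[OF \<pi>])
  qed
  then have "QAP A B = qap_cost A B ?opt"
    unfolding QAP_def dim atLeast0LessThan using opt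
    by (intro Min_eqI) (auto simp: finite_permutations)
  then show ?thesis
    using opt by (simp add: qap_optimal_def atLeast0LessThan)
qed

end
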